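(* Let $\sigma=\{\lambda_1,\lambda_2,\lambda_3,\lambda_4\}$ be a list of complex numbers such that $\sum_{i=1}^{4}\lambda_i\ge 0$, $\overline{\lambda_3}=\lambda_4$, $\lambda_1+\lambda_2\ge 2\,\mathrm{Re}\,\lambda_3$ and $\lambda_1-\lambda_2\ge 2\,|\mathrm{Im}\,\lambda_3|$ (in particular the quantities compared are real). Put $$a=\frac{\lambda_1+\lambda_2+\lambda_3+\lambda_4}{4},\quad b=\frac{\lambda_1+\lambda_2-\lambda_3-\lambda_4}{4},\quad c=\frac{\lambda_1-\lambda_2-i\lambda_3+i\lambda_4}{4},\quad d=\frac{\lambda_1-\lambda_2+i\lambda_3-i\lambda_4}{4},$$ where $i=\sqrt{-1}$. Then the matrix $$M=\begin{pmatrix} a&b&c&d\\ b&a&d&c\\ d&c&a&b\\ c&d&b&a\end{pmatrix}$$ is a nonnegative permutative matrix which realizes $\sigma$.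
   Context: A list is a finite multiset of complex numbers. A nonnegative matrix is a real matrix with all entries $\ge 0$. A square matrix of order $n\ge 2$ is called permutative if each of its rows is a permutation of its first row. A matrix realizes a list $\sigma$ if it is nonnegative and its spectrum (eigenvalues counted with algebraic multiplicity) is $\sigma$. *)

theory Defs
  imports
    "Jordan_Normal_Form.Char_Poly"
    "HOL-Computational_Algebra.Polynomial"
    "HOL-Combinatorics.Permutations"
    "HOL-Library.Complex_Order"
begin

(* Matrices carry complex entries so that eigenvalues can be taken directly; that a matrix is
   real is part of being nonnegative.  The order on complex used in inequalities is the one of
   Complex_Order: x \<le> y means Re x \<le> Re y and Im x = Im y. *)

definition nonnegative_mat :: "complex mat \<Rightarrow> bool" where
  "nonnegative_mat A \<longleftrightarrow>
     (\<forall>i < dim_row A. \<forall>j < dim_col A. A $$ (i, j) \<in> \<real> \<and> 0 \<le> Re (A $$ (i, j)))"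

definition permutative_mat :: "'a mat \<Rightarrow> bool" where
  "permutative_mat A \<longleftrightarrow>
     (\<exists>n \<ge> 2. A \<in> carrier_mat n n \<and>
       (\<forall>i < n. \<exists>p. p permutes {..<n} \<and> (\<forall>j < n. A $$ (i, j) = A $$ (0, p j))))"

definition spectrum_mset :: "complex mat \<Rightarrow> complex multiset" where
  "spectrum_mset A = proots (char_poly A)"

definition realizes :: "complex mat \<Rightarrow> complex multiset \<Rightarrow> bool" where
  "realizes A \<sigma> \<longleftrightarrow> square_mat A \<and> nonnegative_mat A \<and> spectrum_mset A = \<sigma>"

end

theory Submission
  imports Defs
begin

text \<open>
  With \<open>F\<close> the matrix whose columns are \<open>(1, 1, 1, 1)\<close>, \<open>(1, 1, -1, -1)\<close>, \<open>(1, -1, \<i>, -\<i>)\<close> and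
  \<open>(1, -1, -\<i>, \<i>)\<close>, one has \<open>F F\<^sup>* = 4 I\<close>, and the columns of \<open>F\<close> are eigenvectors of \<open>M\<close> for
  \<open>\<lambda>\<^sub>1, \<lambda>\<^sub>2, \<lambda>\<^sub>3, \<lambda>\<^sub>4\<close>; this holds for arbitrary complex \<open>\<lambda>\<^sub>i\<close>.  Conjugacy of \<open>\<lambda>\<^sub>3, \<lambda>\<^sub>4\<close> and the
  inequalities only enter to make the entries of \<open>M\<close> real and nonnegative.
\<close>

lemma less_4_cases:
  fixes i :: nat
  assumes "i < 4"
  obtains "i = 0" | "i = 1" | "i = 2" | "i = 3"
  using assms by linarith

lemma all_less_4: "(\<forall>i<4::nat. P i) \<longleftrightarrow> P 0 \<and> P 1 \<and> P 2 \<and> P 3"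
  by (auto elim: less_4_cases)

text \<open>The bounded quantifiers let \<open>all_less_4\<close> split a matrix identity into
  sixteen scalar equations.\<close>

lemma mat_4_eqI:
  assumes "A \<in> carrier_mat 4 4" "B \<in> carrier_mat 4 4"
    and "\<forall>i<4. \<forall>j<4. A $$ (i, j) = B $$ (i, j)"
  shows "A = B"
  using assms by (intro eq_matI) auto

lemma atLeastLessThan_0_4: "{0..<4::nat} = {0, 1, 2, 3}"
  by auto

text \<open>\<open>proots\<close> is additive on nonzero products, so a factored characteristic
  polynomial yields its roots with multiplicity.\<close>

lemma proots_prod_linear_factors:
  fixes xs :: "'a :: idom list"
  shows "proots (\<Prod>x\<leftarrow>xs. [:- x, 1:]) = mset xs"
proof (induction xs)
  case (Cons x xs)
  have "(\<Prod>x\<leftarrow>xs. [:- x, 1:]) \<noteq> 0"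
    by (auto simp: prod_list_zero_iff)
  then have "proots ([:- x, 1:] * (\<Prod>x\<leftarrow>xs. [:- x, 1:])) =
      proots [:- x, 1:] + proots (\<Prod>x\<leftarrow>xs. [:- x, 1:])"
    by (intro proots_mult) auto
  with Cons.IH show ?case
    by simp
qed simp

text \<open>Similarity preserves \<open>char_poly\<close>, which for a triangular matrix splits into
  linear factors over the diagonal.\<close>

lemma spectrum_mset_similar_upper_triangular:
  assumes "similar_mat A D" "D \<in> carrier_mat n n" "upper_triangular D"
  shows "spectrum_mset A = mset (diag_mat D)"
  using char_poly_similar[OF assms(1)] char_poly_upper_triangular[OF assms(2,3)]
  by (simp add: spectrum_mset_def proots_prod_linear_factors)

lemma spectrum_mset_block_permutative:
  fixes l1 l2 l3 l4 :: complex
  assumes a: "a = (l1 + l2 + l3 + l4) / 4"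
    and b: "b = (l1 + l2 - l3 - l4) / 4"
    and c: "c = (l1 - l2 - \<i> * l3 + \<i> * l4) / 4"
    and d: "d = (l1 - l2 + \<i> * l3 - \<i> * l4) / 4"
  shows "spectrum_mset (mat_of_rows_list 4
           [[a, b, c, d], [b, a, d, c], [d, c, a, b], [c, d, b, a]]) = {#l1, l2, l3, l4#}"
    (is "spectrum_mset ?M = _")
proof -
  define D where "D = mat_of_rows_list 4
    [[l1, 0, 0, 0], [0, l2, 0, 0], [0, 0, l3, 0], [0, 0, 0, l4]]"
  define F where "F = mat_of_rows_list 4
    [[1, 1, 1, 1], [1, 1, -1, -1], [1, -1, \<i>, -\<i>], [1, -1, -\<i>, \<i>]]"
  \<comment> \<open>\<open>G\<close> is the conjugate transpose of \<open>F\<close> divided by 4,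
    hence its inverse.\<close>
  define G where "G = mat_of_rows_list 4
    [[1/4, 1/4, 1/4, 1/4], [1/4, 1/4, -1/4, -1/4],
     [1/4, -1/4, -\<i>/4, \<i>/4], [1/4, -1/4, \<i>/4, -\<i>/4]]"
  note defs = D_def F_def G_def mat_of_rows_list_def
  note expand = defs scalar_prod_def atLeastLessThan_0_4
  have M: "?M \<in> carrier_mat 4 4" and D: "D \<in> carrier_mat 4 4"
    and F: "F \<in> carrier_mat 4 4" and G: "G \<in> carrier_mat 4 4"
    by (auto simp: defs)
  have FG: "F * G = 1\<^sub>m 4" "G * F = 1\<^sub>m 4"
    using F G by (intro mat_4_eqI; simp add: all_less_4 expand)+
  have "?M = F * D * G"
    using M D F G by (intro mat_4_eqI; simp add: all_less_4 expand a b c d field_simps)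
  with FG M D F G have "similar_mat ?M D"
    unfolding similar_mat_def by (intro exI similar_mat_witI)
  moreover have "\<forall>i<4. \<forall>j<4. j < i \<longrightarrow> D $$ (i, j) = 0"
    by (simp add: all_less_4 defs)
  then have "upper_triangular D"
    using D by (auto simp: upper_triangular_def)
  moreover have "diag_mat D = [l1, l2, l3, l4]"
    by (simp add: diag_mat_def defs upt_rec)
  ultimately show ?thesis
    using spectrum_mset_similar_upper_triangular[OF _ D] by simp
qed

text \<open>The four rows come from the first by the powers of the 4-cycle 0 -> 3 -> 1 -> 2 -> 0:
  for \<open>i\<close> = 0, 1, 2, 3 these are the identity, the square, the cycle itself and its
  inverse, written below as products of transpositions.\<close>

lemma permutative_mat_block_permutative:
  "permutative_mat (mat_of_rows_list 4
     [[a, b, c, d], [b, a, d, c], [d, c, a, b], [c, d, b, a]])"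
  (is "permutative_mat ?M")
  unfolding permutative_mat_def
proof (intro exI[of _ 4] conjI allI impI)
  fix i :: nat assume "i < 4"
  have rows: "?M $$ (i, j) = [[a, b, c, d], [b, a, d, c], [d, c, a, b], [c, d, b, a]] ! i ! j"
    if "i < 4" "j < 4" for i j
    using that by (simp add: mat_of_rows_list_def)
  have perm: "transpose x y permutes {..<4}" if "x < 4" "y < 4" for x y :: nat
    using that by (intro permutes_swap_id) auto
  have *: "\<exists>p. p permutes {..<4} \<and> (\<forall>j<4. ?M $$ (i, j) = ?M $$ (0, p j))"
    if "p permutes {..<4}" "\<forall>j<4. ?M $$ (i, j) = ?M $$ (0, p j)" for p
    using that by blast
  note t = rows transpose_def
  from \<open>i < 4\<close> show "\<exists>p. p permutes {..<4} \<and> (\<forall>j<4. ?M $$ (i, j) = ?M $$ (0, p j))"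
  proof (cases rule: less_4_cases)
    case 1
    show ?thesis
      by (rule *[of id]) (simp_all add: 1 permutes_id)
  next
    case 2
    show ?thesis
      by (rule *[of "transpose 0 1 \<circ> transpose 2 3"])
         (auto intro!: permutes_compose perm simp: 2 t elim!: less_4_cases)
  next
    case 3
    show ?thesis
      by (rule *[of "transpose 0 2 \<circ> (transpose 0 1 \<circ> transpose 0 3)"])
         (auto intro!: permutes_compose perm simp: 3 t elim!: less_4_cases)
  next
    case 4
    show ?thesis
      by (rule *[of "transpose 0 3 \<circ> (transpose 0 1 \<circ> transpose 0 2)"])
         (auto intro!: permutes_compose perm simp: 4 t elim!: less_4_cases)
  qed
qed (auto simp: mat_of_rows_list_def)

theorem theorem11:
  fixes \<sigma> :: "complex multiset"
    and l1 l2 l3 l4 a b c d :: complex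
    and M :: "complex mat"
  assumes "\<sigma> = {#l1, l2, l3, l4#}"
    and "0 \<le> l1 + l2 + l3 + l4"
    and "cnj l3 = l4"
    and "complex_of_real (2 * Re l3) \<le> l1 + l2"
    and "complex_of_real (2 * \<bar>Im l3\<bar>) \<le> l1 - l2"
    and "a = (l1 + l2 + l3 + l4) / 4"
    and "b = (l1 + l2 - l3 - l4) / 4"
    and "c = (l1 - l2 - \<i> * l3 + \<i> * l4) / 4"
    and "d = (l1 - l2 + \<i> * l3 - \<i> * l4) / 4"
    and "M = mat_of_rows_list 4
          [[a, b, c, d],
           [b, a, d, c],
           [d, c, a, b],
           [c, d, b, a]]"
  shows "nonnegative_mat M \<and> permutative_mat M \<and> realizes M \<sigma>"
proof -
  note M = assms(10)
  have l4: "Re l4 = Re l3" "Im l4 = - Im l3"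
    using assms(3) by auto
  \<comment> \<open>As \<open>l4\<close> is conjugate to \<open>l3\<close>, the numerators of
    \<open>b\<close>, \<open>c\<close>, \<open>d\<close> are \<open>l1 + l2 - 2 * Re l3\<close> and
    \<open>l1 - l2\<close> plus or minus \<open>2 * Im l3\<close>. The order on complex numbers also
    makes \<open>l1 + l2\<close> and \<open>l1 - l2\<close> real.\<close>
  have "a \<in> \<real> \<and> 0 \<le> Re a" "b \<in> \<real> \<and> 0 \<le> Re b" "c \<in> \<real> \<and> 0 \<le> Re c" "d \<in> \<real> \<and> 0 \<le> Re d"
    using assms(2,4,5) l4 unfolding assms(6-9)
    by (auto simp: less_eq_complex_def complex_is_Real_iff)
  moreover have "dim_row M = 4" "dim_col M = 4"
    by (simp_all add: M mat_of_rows_list_def)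
  ultimately have nonneg: "nonnegative_mat M"
    \<comment> \<open>\<open>M\<close> stays folded at first, so that its known dimensions rewrite
      the index bounds to 4.\<close>
    by (simp add: nonnegative_mat_def all_less_4) (simp add: M mat_of_rows_list_def)
  moreover have "permutative_mat M"
    unfolding M by (rule permutative_mat_block_permutative)
  moreover have "realizes M \<sigma>"
    using nonneg spectrum_mset_block_permutative[OF assms(6-9)]
    by (simp add: realizes_def assms(1) M mat_of_rows_list_def)
  ultimately show ?thesis
    by blast
qed

end
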